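(* For every finite Abelian group $G$, $\mathrm{Aut}(\mathcal{L}(G))\cap S_n\cong \mathrm{Aut}(G)$, where $\mathrm{Aut}(G)$ is the automorphism group of the group $G$.
   Context: Let $G=\{0,g_1,\dots,g_n\}$ be a finite Abelian (additive) group of order $n+1$, with its nonzero elements listed as $g_1,\dots,g_n$. Define $$\mathcal{L}(G)=\Big\{X=(x_1,\dots,x_n,-x_1-\cdots-x_n)\in\mathbb{Z}^{n+1}:\ x_1g_1+\cdots+x_ng_n=0\Big\},$$ a full-rank sublattice of $\mathcal{A}_n=\{(x_1,\dots,x_n,-x_1-\cdots-x_n)\in\mathbb{Z}^{n+1}\}$. The automorphism group $\mathrm{Aut}(\mathcal{L}(G))$ is the group of all maps of $\mathcal{L}(G)$ onto itself which extend to linear isometries of $\mathrm{span}_{\mathbb{R}}\mathcal{A}_n$. Every such map has the form $(x,-\sum_i x_i)\mapsto (Ux,-\sum_i (Ux)_i)$ for $x=(x_1,\dots,x_n)^\top$ and some $U\in\mathrm{GL}_n(\mathbb{Z})$, and $\mathrm{Aut}(\mathcal{L}(G))$ is identified with the corresponding subgroup of $\mathrm{GL}_n(\mathbb{Z})$. $S_n$ denotes the symmetric group on $n$ letters, viewed as the subgroup of permutation matrices in $\mathrm{GL}_n(\mathbb{Z})$. *)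

theory Defs
  imports "HOL-Algebra.Bij" "HOL-Algebra.FiniteProduct" "HOL-Combinatorics.Permutations"
    "Jordan_Normal_Form.VS_Connect"
begin

text \<open>
  Coordinates are indexed from \<open>0\<close>: the nonzero elements of the group are
  \<open>g 0, \<dots>, g (n - 1)\<close>. The group is a (multiplicatively written)
  structure of \<^theory>\<open>HOL-Algebra.Group\<close>, so \<open>x\<^sub>1 g\<^sub>1 + \<dots> + x\<^sub>n g\<^sub>n = 0\<close>
  is a product of integer powers being \<open>\<one>\<close>.
\<close>

definition embed :: "nat \<Rightarrow> int vec \<Rightarrow> int vec" where
  "embed n x = vec (Suc n) (\<lambda>i. if i < n then x $ i else - (\<Sum>j<n. x $ j))"

definition root_lattice :: "nat \<Rightarrow> int vec set" where
  "root_lattice n = embed n ` carrier_vec n"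

definition group_lattice :: "('a, 'b) monoid_scheme \<Rightarrow> nat \<Rightarrow> (nat \<Rightarrow> 'a) \<Rightarrow> int vec set" where
  "group_lattice G n g =
     {embed n x | x. x \<in> carrier_vec n \<and>
        finprod G (\<lambda>i. g i [^]\<^bsub>G\<^esub> (x $ i)) {..<n} = \<one>\<^bsub>G\<^esub>}"

definition root_space :: "nat \<Rightarrow> real vec set" where
  "root_space n = LinearCombinations.module.span class_ring (module_vec TYPE(real) (Suc n))
     (map_vec real_of_int ` root_lattice n)"

text \<open>
  Isometry is stated for the squared Euclidean norm. Surjectivity of \<open>T\<close> on \<open>root_space n\<close>
  is automatic, the space being finite-dimensional.
\<close>

definition linear_isometries :: "nat \<Rightarrow> (real vec \<Rightarrow> real vec) set" where
  "linear_isometries n =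
     {T. T \<in> LinearCombinations.module_hom class_ring
               (module_vec TYPE(real) (Suc n) \<lparr>carrier := root_space n\<rparr>)
               (module_vec TYPE(real) (Suc n) \<lparr>carrier := root_space n\<rparr>) \<and>
         (\<forall>v \<in> root_space n. T v \<bullet> T v = v \<bullet> v)}"

definition lattice_aut :: "nat \<Rightarrow> int vec set \<Rightarrow> (int vec \<Rightarrow> int vec) set" where
  "lattice_aut n L =
     {f \<in> extensional L. f ` L = L \<and>
        (\<exists>T \<in> linear_isometries n. \<forall>v \<in> L.
           map_vec real_of_int (f v) = T (map_vec real_of_int v))}"

definition GL_int :: "nat \<Rightarrow> int mat monoid" where
  "GL_int n = units_of (ring_mat TYPE(int) n ())"

text \<open>
  The lattice automorphisms as matrices: \<open>U\<close> represents the map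
  \<open>(x, - (\<Sum>i. x\<^sub>i)) \<mapsto> (U x, - (\<Sum>i. (U x)\<^sub>i))\<close>.
\<close>

definition lattice_aut_mat :: "nat \<Rightarrow> int vec set \<Rightarrow> int mat set" where
  "lattice_aut_mat n L =
     {U \<in> carrier (GL_int n). \<exists>f \<in> lattice_aut n L.
        \<forall>x \<in> carrier_vec n. embed n x \<in> L \<longrightarrow> f (embed n x) = embed n (U *\<^sub>v x)}"

definition perm_mat :: "nat \<Rightarrow> (nat \<Rightarrow> nat) \<Rightarrow> int mat" where
  "perm_mat n p = mat n n (\<lambda>(i, j). if i = p j then 1 else 0)"

definition perm_mats :: "nat \<Rightarrow> int mat set" where
  "perm_mats n = {perm_mat n p | p. p permutes {..<n}}"

end

theory Submission
  imports Defs
begin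

text \<open>
  A permutation matrix acts on the lattice by permuting the first \<open>n\<close> coordinates, which is
  always an isometry; so it lies in the automorphism group iff the coordinate permutation \<open>p\<close>
  preserves the set of relations between \<open>g\<^sub>1, \<dots>, g\<^sub>n\<close>. The relations
  \<open>g\<^sub>i + g\<^sub>j = g\<^sub>k\<close> and \<open>g\<^sub>i + g\<^sub>j = 0\<close> encode the whole addition table, so this happens iff
  the bijection of \<open>G\<close> that fixes \<open>0\<close> and sends \<open>g\<^sub>i\<close> to \<open>g\<^bsub>p i\<^esub>\<close> is an automorphism.
\<close>

section \<open>Permutation matrices as lattice automorphisms\<close>

lemma perm_mat_carrier [simp]: "perm_mat n p \<in> carrier_mat n n"
  by (simp add: perm_mat_def)

text \<open>Column \<open>j\<close> is the unit vector at \<open>p j\<close>, so the entry arriving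
  at position \<open>i\<close> comes from the index that \<open>p\<close> sends to
  \<open>i\<close>.\<close>

lemma perm_mat_mult_vec_index:
  assumes p: "p permutes {..<n}" and x: "x \<in> carrier_vec n" and i: "i < n"
  shows "(perm_mat n p *\<^sub>v x) $ i = x $ Hilbert_Choice.inv p i"
proof -
  have "(perm_mat n p *\<^sub>v x) $ i = (\<Sum>j = 0..<n. (if i = p j then 1 else 0) * x $ j)"
    using x i by (simp add: perm_mat_def scalar_prod_def)
  also have "\<dots> = (\<Sum>j = 0..<n. if j = Hilbert_Choice.inv p i then x $ j else 0)"
    using permutes_inverses[OF p] by (intro sum.cong) auto
  also have "\<dots> = x $ Hilbert_Choice.inv p i"
    using permutes_in_image[OF permutes_inv[OF p], of i] i by simp
  finally show ?thesis .
qed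

text \<open>With \<open>p\<close> read along columns, the order of composition is kept, so passing
  to matrices is a homomorphism and not an antihomomorphism.\<close>

lemma perm_mat_mult:
  assumes q: "q permutes {..<n}"
  shows "perm_mat n p * perm_mat n q = perm_mat n (p \<circ> q)"
proof (rule eq_matI)
  fix i k assume "i < dim_row (perm_mat n (p \<circ> q))" "k < dim_col (perm_mat n (p \<circ> q))"
  then have ik: "i < n" "k < n" by (auto simp: perm_mat_def)
  have "(perm_mat n p * perm_mat n q) $$ (i, k)
      = (\<Sum>j = 0..<n. (if i = p j then 1 else 0) * (if j = q k then 1 else 0))"
    using ik by (simp add: perm_mat_def scalar_prod_def)
  also have "\<dots> = (\<Sum>j = 0..<n. if j = q k then (if i = p j then 1 else 0) else 0)"
    by (intro sum.cong) auto
  also have "\<dots> = perm_mat n (p \<circ> q) $$ (i, k)"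
    using permutes_in_image[OF q, of k] ik by (simp add: perm_mat_def)
  finally show "(perm_mat n p * perm_mat n q) $$ (i, k) = perm_mat n (p \<circ> q) $$ (i, k)" .
qed (auto simp: perm_mat_def)

lemma perm_mat_id: "perm_mat n id = 1\<^sub>m n"
  by (rule eq_matI) (auto simp: perm_mat_def)

lemma perm_mat_eqD:
  assumes eq: "perm_mat n p = perm_mat n q" and p: "p permutes {..<n}" and i: "i < n"
  shows "p i = q i"
proof -
  \<comment> \<open>Column \<open>i\<close> has its only 1 in row \<open>p i\<close>; the bound
    ensures that this row lies inside the matrix.\<close>
  have "p i < n" using permutes_in_image[OF p, of i] i by simp
  moreover have "perm_mat n p $$ (p i, i) = perm_mat n q $$ (p i, i)" using eq by simp
  ultimately show ?thesis using i by (simp add: perm_mat_def split: if_splits)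
qed

lemma perm_mat_in_GL_int:
  assumes p: "p permutes {..<n}"
  shows "perm_mat n p \<in> carrier (GL_int n)"
proof -
  have "perm_mat n p * perm_mat n (Hilbert_Choice.inv p) = 1\<^sub>m n" "perm_mat n (Hilbert_Choice.inv p) * perm_mat n p = 1\<^sub>m n"
    using perm_mat_mult[OF p] perm_mat_mult[OF permutes_inv[OF p]]
    by (simp_all add: permutes_inv_o[OF p] perm_mat_id)
  moreover have "perm_mat n (Hilbert_Choice.inv p) \<in> carrier_mat n n" by simp
  ultimately show ?thesis
    by (auto simp: GL_int_def units_of_carrier Units_def ring_mat_simps)
qed

section \<open>Coordinate permutations on embedded vectors\<close>

text \<open>Polymorphic in the entries, so that one operation serves both the integer lattice and
  the real space carrying the isometry. The inverse matches the action of
  \<open>perm_mat\<close>.\<close>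

definition permute_vec :: "(nat \<Rightarrow> nat) \<Rightarrow> 'a vec \<Rightarrow> 'a vec" where
  "permute_vec p v = vec (dim_vec v) (\<lambda>i. v $ Hilbert_Choice.inv p i)"

lemma embed_carrier [simp]: "embed n x \<in> carrier_vec (Suc n)"
  by (simp add: embed_def)

lemma inj_on_embed: "inj_on (embed n) (carrier_vec n)"
proof (rule inj_onI)
  fix x y assume x: "x \<in> carrier_vec n" and y: "y \<in> carrier_vec n" and eq: "embed n x = embed n y"
  show "x = y"
  proof (rule eq_vecI)
    fix i assume "i < dim_vec y"
    with y have "i < n" by simp
    with arg_cong[OF eq, of "\<lambda>v. v $ i"] show "x $ i = y $ i" by (simp add: embed_def)
  qed (use x y in simp)
qed

text \<open>The last coordinate is minus the sum of the others: that sum is invariant under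
  reindexing, and \<open>p\<close> fixes the index \<open>n\<close>.\<close>

lemma embed_perm_mat:
  assumes p: "p permutes {..<n}" and x: "x \<in> carrier_vec n"
  shows "embed n (perm_mat n p *\<^sub>v x) = permute_vec p (embed n x)"
proof (rule eq_vecI)
  fix i assume "i < dim_vec (permute_vec p (embed n x))"
  then have i: "i < Suc n" by (simp add: permute_vec_def embed_def)
  show "embed n (perm_mat n p *\<^sub>v x) $ i = permute_vec p (embed n x) $ i"
  proof (cases "i < n")
    case True
    then have "Hilbert_Choice.inv p i < n" using permutes_in_image[OF permutes_inv[OF p], of i] by simp
    with True show ?thesis
      by (simp add: embed_def permute_vec_def perm_mat_mult_vec_index[OF p x])
  next
    case False
    with i have i: "i = n" by simp
    have "Hilbert_Choice.inv p n = n" using permutes_not_in[OF permutes_inv[OF p]] by simp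
    moreover have "(\<Sum>j<n. (perm_mat n p *\<^sub>v x) $ j) = (\<Sum>j<n. x $ j)"
      using sum.permute[OF permutes_inv[OF p], of "\<lambda>j. x $ j"]
      by (simp add: perm_mat_mult_vec_index[OF p x] o_def)
    ultimately show ?thesis by (simp add: i embed_def permute_vec_def)
  qed
qed (simp add: embed_def permute_vec_def)

section \<open>Isometries of the root space and the membership criterion\<close>

text \<open>The preimage of the span under \<open>T\<close> is a submodule containing the
  generators, hence contains the whole span.\<close>

lemma root_space_closed_under_linear:
  assumes add: "\<And>v w. v \<in> carrier_vec (Suc n) \<Longrightarrow> w \<in> carrier_vec (Suc n) \<Longrightarrow> T (v + w) = T v + T w"
    and smult: "\<And>c v. v \<in> carrier_vec (Suc n) \<Longrightarrow> T (c \<cdot>\<^sub>v v) = c \<cdot>\<^sub>v T v"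
    and closed: "T \<in> carrier_vec (Suc n) \<rightarrow> carrier_vec (Suc n)"
    and lat: "\<And>v. v \<in> root_lattice n \<Longrightarrow> T (map_vec real_of_int v) \<in> map_vec real_of_int ` root_lattice n"
  shows "T \<in> root_space n \<rightarrow> root_space n"
proof -
  interpret V: vec_module "TYPE(real)" "Suc n" .
  let ?S = "map_vec real_of_int ` root_lattice n"
  have S: "?S \<subseteq> carrier_vec (Suc n)" by (auto simp: root_lattice_def)
  have sub: "submodule class_ring (V.span ?S) V.V" by (rule V.span_is_submodule[OF S])
  have own: "?S \<subseteq> V.span ?S" by (rule V.in_own_span[OF S])
  \<comment> \<open>Homogeneity with scalar 0 gives the value at zero.\<close>
  have T0: "T (0\<^sub>v (Suc n)) = 0\<^sub>v (Suc n)"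
    using smult[of "0\<^sub>v (Suc n)" 0] closed by (auto simp: Pi_def)
  have "submodule class_ring {v \<in> carrier_vec (Suc n). T v \<in> V.span ?S} V.V"
    using submodule.m_closed[OF sub] submodule.zero_closed[OF sub] submodule.smult_closed[OF sub]
    by (intro submodule.intro vec_module) (auto simp: module_vec_simps class_ring_simps add smult T0)
  then have "V.span ?S \<subseteq> {v \<in> carrier_vec (Suc n). T v \<in> V.span ?S}"
    using S own lat by (intro V.span_is_subset) blast+
  then show ?thesis by (auto simp: root_space_def)
qed

lemma permute_vec_isometry:
  assumes p: "p permutes {..<n}"
  shows "permute_vec p \<in> linear_isometries n"
proof -
  \<comment> \<open>The ambient space has one more coordinate, which \<open>p\<close> leaves in
    place.\<close>
  have p': "p permutes {..<Suc n}" using p by (rule permutes_subset) auto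
  have inv_less: "Hilbert_Choice.inv p i < Suc n" if "i < Suc n" for i
    using permutes_in_image[OF permutes_inv[OF p'], of i] that by simp
  have add: "permute_vec p (v + w) = permute_vec p v + permute_vec p w"
    if "v \<in> carrier_vec (Suc n)" "w \<in> carrier_vec (Suc n)" for v w :: "real vec"
    using that inv_less by (intro eq_vecI) (auto simp: permute_vec_def)
  have smult: "permute_vec p (c \<cdot>\<^sub>v v) = c \<cdot>\<^sub>v permute_vec p v"
    if "v \<in> carrier_vec (Suc n)" for c and v :: "real vec"
    using that inv_less by (intro eq_vecI) (auto simp: permute_vec_def)
  have lat: "permute_vec p (map_vec real_of_int v) \<in> map_vec real_of_int ` root_lattice n"
    if v_in: "v \<in> root_lattice n" for v
  proof -
    obtain x where x: "x \<in> carrier_vec n" and v: "v = embed n x"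
      using v_in unfolding root_lattice_def by blast
    \<comment> \<open>On the lattice, \<open>permute_vec p\<close> is the embedded form of an
      integer matrix, so it produces embedded integer vectors again.\<close>
    have "permute_vec p v \<in> root_lattice n"
      unfolding v embed_perm_mat[OF p x, symmetric] root_lattice_def
      using x by (intro imageI) (rule mult_mat_vec_carrier[OF perm_mat_carrier])
    moreover have "permute_vec p (map_vec real_of_int v) = map_vec real_of_int (permute_vec p v)"
      using inv_less by (intro eq_vecI) (auto simp: permute_vec_def v embed_def)
    ultimately show ?thesis by simp
  qed
  have closed: "permute_vec p \<in> root_space n \<rightarrow> root_space n"
    using add smult lat by (intro root_space_closed_under_linear) (auto simp: permute_vec_def)
  interpret V: vec_module "TYPE(real)" "Suc n" .
  have sub: "root_space n \<subseteq> carrier_vec (Suc n)"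
    unfolding root_space_def by (rule V.span_is_subset2) (auto simp: root_lattice_def)
  have norm: "permute_vec p v \<bullet> permute_vec p v = v \<bullet> v" if "v \<in> carrier_vec (Suc n)" for v :: "real vec"
    using that sum.permute[OF permutes_inv[OF p'], of "\<lambda>i. v $ i * v $ i"]
    by (simp add: scalar_prod_def permute_vec_def atLeast0LessThan o_def)
  show ?thesis
    using closed add smult norm sub
    by (auto simp: linear_isometries_def LinearCombinations.module_hom_def module_vec_simps
        class_ring_simps subset_iff)
qed

text \<open>A lattice automorphism represented by \<open>perm_mat n p\<close> must agree with
  \<open>permute_vec p\<close> on \<open>L\<close>. Conversely the real coordinate permutation is an
  isometry extending the integer one, so only the condition on the image of \<open>L\<close>
  remains.\<close>

lemma perm_mat_in_lattice_aut_mat_iff: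
  assumes p: "p permutes {..<n}" and L: "L \<subseteq> root_lattice n"
  shows "perm_mat n p \<in> lattice_aut_mat n L \<longleftrightarrow> permute_vec p ` L = L"
proof
  assume "perm_mat n p \<in> lattice_aut_mat n L"
  then obtain f where f: "f \<in> lattice_aut n L"
    and fU: "\<And>x. x \<in> carrier_vec n \<Longrightarrow> embed n x \<in> L \<Longrightarrow> f (embed n x) = embed n (perm_mat n p *\<^sub>v x)"
    by (auto simp: lattice_aut_mat_def)
  have "permute_vec p v = f v" if "v \<in> L" for v
    using that L fU embed_perm_mat[OF p] by (auto simp: root_lattice_def)
  then have "permute_vec p ` L = f ` L" by simp
  then show "permute_vec p ` L = L" using f by (simp add: lattice_aut_def)
next
  assume im: "permute_vec p ` L = L"
  have p': "p permutes {..<Suc n}" using p by (rule permutes_subset) auto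
  have real: "map_vec real_of_int (permute_vec p v) = permute_vec p (map_vec real_of_int v)"
    if "v \<in> L" for v
  proof (rule eq_vecI)
    have "dim_vec v = Suc n" using that L by (auto simp: root_lattice_def embed_def)
    then show "map_vec real_of_int (permute_vec p v) $ i = permute_vec p (map_vec real_of_int v) $ i"
      if "i < dim_vec (permute_vec p (map_vec real_of_int v))" for i
      using that permutes_in_image[OF permutes_inv[OF p'], of i] by (simp add: permute_vec_def)
  qed (simp add: permute_vec_def)
  \<comment> \<open>Restriction makes the map extensional, as \<open>lattice_aut\<close>
    demands.\<close>
  have "restrict (permute_vec p) L \<in> lattice_aut n L"
    using im real permute_vec_isometry[OF p] by (auto simp: lattice_aut_def)
  moreover have "restrict (permute_vec p) L (embed n x) = embed n (perm_mat n p *\<^sub>v x)"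
    if "x \<in> carrier_vec n" "embed n x \<in> L" for x
    using that by (simp add: embed_perm_mat[OF p])
  ultimately show "perm_mat n p \<in> lattice_aut_mat n L"
    using perm_mat_in_GL_int[OF p] unfolding lattice_aut_mat_def by blast
qed

section \<open>Relations in an enumerated group\<close>

context comm_group
begin

text \<open>The family \<open>h\<close> is kept variable because the relations of \<open>g\<close>
  are compared with those of \<open>g \<circ> p\<close> and
  \<open>\<sigma> \<circ> g\<close>.\<close>

definition int_comb :: "nat \<Rightarrow> (nat \<Rightarrow> 'a) \<Rightarrow> int vec \<Rightarrow> 'a" where
  "int_comb n h x = finprod G (\<lambda>i. h i [^] (x $ i)) {..<n}"

lemma int_comb_add:
  assumes "h \<in> {..<n} \<rightarrow> carrier G" "x \<in> carrier_vec n" "y \<in> carrier_vec n"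
  shows "int_comb n h (x + y) = int_comb n h x \<otimes> int_comb n h y"
proof -
  have "int_comb n h (x + y) = finprod G (\<lambda>i. h i [^] (x $ i) \<otimes> h i [^] (y $ i)) {..<n}"
    unfolding int_comb_def using assms by (intro finprod_cong') (auto simp: int_pow_mult Pi_def)
  also have "\<dots> = int_comb n h x \<otimes> int_comb n h y"
    unfolding int_comb_def using assms by (intro finprod_multf) auto
  finally show ?thesis .
qed

lemma int_comb_closed:
  "h \<in> {..<n} \<rightarrow> carrier G \<Longrightarrow> int_comb n h x \<in> carrier G"
  by (auto simp: int_comb_def intro!: finprod_closed)

lemma int_comb_smult_unit_vec:
  assumes h: "h \<in> {..<n} \<rightarrow> carrier G" and k: "k < n"
  shows "int_comb n h (c \<cdot>\<^sub>v unit_vec n k) = h k [^] c"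
proof -
  have "int_comb n h (c \<cdot>\<^sub>v unit_vec n k) = finprod G (\<lambda>i. if i = k then h i [^] c else \<one>) {..<n}"
    unfolding int_comb_def using h k by (intro finprod_cong') (auto simp: Pi_def unit_vec_def)
  also have "\<dots> = h k [^] c"
    using h k by (intro finprod_singleton_swap) auto
  finally show ?thesis .
qed

lemma int_comb_unit_vec:
  assumes "h \<in> {..<n} \<rightarrow> carrier G" "k < n"
  shows "int_comb n h (unit_vec n k) = h k"
  using int_comb_smult_unit_vec[OF assms, of 1] assms by (auto simp: Pi_def)

text \<open>Reindexing the product along \<open>p\<close> moves the permutation from the
  coefficients to the group elements.\<close>

lemma int_comb_perm_mat:
  assumes h: "h \<in> {..<n} \<rightarrow> carrier G" and p: "p permutes {..<n}" and x: "x \<in> carrier_vec n"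
  shows "int_comb n h (perm_mat n p *\<^sub>v x) = int_comb n (h \<circ> p) x"
proof -
  have "int_comb n h (perm_mat n p *\<^sub>v x) = finprod G (\<lambda>i. h i [^] (x $ Hilbert_Choice.inv p i)) (p ` {..<n})"
    unfolding int_comb_def permutes_image[OF p]
    using h x by (intro finprod_cong') (auto simp: perm_mat_mult_vec_index[OF p])
  also have "\<dots> = finprod G (\<lambda>i. h (p i) [^] (x $ Hilbert_Choice.inv p (p i))) {..<n}"
    using h by (intro finprod_reindex permutes_inj_on[OF p]) (auto simp: permutes_image[OF p] Pi_def)
  finally show ?thesis by (simp add: int_comb_def permutes_inverses[OF p])
qed

lemma int_comb_hom:
  assumes \<sigma>: "\<sigma> \<in> hom G G" and h: "h \<in> {..<n} \<rightarrow> carrier G"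
  shows "\<sigma> (int_comb n h x) = int_comb n (\<sigma> \<circ> h) x"
proof -
  interpret \<sigma>: group_hom G G \<sigma> by unfold_locales (rule \<sigma>)
  have "\<sigma> (finprod G f A) = finprod G (\<sigma> \<circ> f) A" if "f \<in> A \<rightarrow> carrier G" for f and A :: "nat set"
    using that by (induction A rule: infinite_finite_induct) (auto simp: Pi_def)
  moreover have "(\<lambda>i. h i [^] (x $ i)) \<in> {..<n} \<rightarrow> carrier G" using h by auto
  moreover have "finprod G (\<sigma> \<circ> (\<lambda>i. h i [^] (x $ i))) {..<n} = int_comb n (\<sigma> \<circ> h) x"
    unfolding int_comb_def using h by (intro finprod_cong') (auto simp: \<sigma>.hom_int_pow Pi_def)
  ultimately show ?thesis by (simp add: int_comb_def)
qed

text \<open>Injectivity of \<open>embed\<close> identifies the vector hidden in the set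
  comprehension with \<open>x\<close>, so membership becomes a single relation.\<close>

lemma embed_in_group_lattice_iff:
  assumes x: "x \<in> carrier_vec n"
  shows "embed n x \<in> group_lattice G n g \<longleftrightarrow> int_comb n g x = \<one>"
proof
  assume "embed n x \<in> group_lattice G n g"
  then obtain y where y: "y \<in> carrier_vec n" "embed n x = embed n y" "int_comb n g y = \<one>"
    unfolding group_lattice_def int_comb_def by blast
  then show "int_comb n g x = \<one>" using inj_onD[OF inj_on_embed y(2) x y(1)] by simp
next
  assume "int_comb n g x = \<one>"
  with x show "embed n x \<in> group_lattice G n g"
    unfolding group_lattice_def int_comb_def by blast
qed

end

section \<open>Automorphisms as permutations of indices\<close>

locale enumerated_comm_group = comm_group G for G :: "('a, 'b) monoid_scheme" (structure) +
  fixes n :: nat and g :: "nat \<Rightarrow> 'a"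
  assumes enum: "bij_betw g {..<n} (carrier G - {\<one>})"
begin

text \<open>Extended by the identity beyond \<open>n\<close>, so that it is a permutation in the
  sense of \<open>permutes\<close> and can equal a given \<open>p\<close> as a function.\<close>

definition index_perm :: "('a \<Rightarrow> 'a) \<Rightarrow> nat \<Rightarrow> nat" where
  "index_perm \<sigma> i = (if i < n then inv_into {..<n} g (\<sigma> (g i)) else i)"

lemma enum_Pi: "g \<in> {..<n} \<rightarrow> carrier G"
  using bij_betw_imp_surj_on[OF enum] by auto

lemma enum_closed: "i < n \<Longrightarrow> g i \<in> carrier G" and enum_not_one: "i < n \<Longrightarrow> g i \<noteq> \<one>"
  using bij_betw_imp_surj_on[OF enum] by auto

lemma carrier_cases:
  assumes "a \<in> carrier G"
  obtains "a = \<one>" | i where "i < n" "a = g i"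
  using assms bij_betw_imp_surj_on[OF enum] by (cases "a = \<one>") (auto simp: set_eq_iff image_iff)

lemma auto_bij_nonone:
  assumes "\<sigma> \<in> auto G"
  shows "bij_betw \<sigma> (carrier G - {\<one>}) (carrier G - {\<one>})"
proof -
  have \<sigma>: "bij_betw \<sigma> (carrier G) (carrier G)" "\<sigma> \<one> = \<one>"
    using assms hom_one[of \<sigma> G G] is_group by (auto simp: auto_def Bij_def)
  have "bij_betw \<sigma> (carrier G - {\<one>}) (carrier G - {\<sigma> \<one>})"
    using \<sigma>(1) by (auto simp: bij_betw_def inj_on_def)
  then show ?thesis by (simp add: \<sigma>)
qed

lemma enum_index_perm:
  assumes \<sigma>: "\<sigma> \<in> auto G" and i: "i < n"
  shows "g (index_perm \<sigma> i) = \<sigma> (g i)"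
proof -
  have "\<sigma> (g i) \<in> g ` {..<n}"
    using auto_bij_nonone[OF \<sigma>] enum_closed[OF i] enum_not_one[OF i]
    unfolding bij_betw_imp_surj_on[OF enum] by (auto simp: bij_betw_def)
  with i show ?thesis by (simp add: index_perm_def f_inv_into_f)
qed

lemma index_perm_eqI:
  assumes "i < n" "j < n" "\<sigma> (g i) = g j"
  shows "index_perm \<sigma> i = j"
  using assms bij_betw_imp_inj_on[OF enum] by (simp add: index_perm_def inv_into_f_f)

lemma index_perm_permutes:
  assumes \<sigma>: "\<sigma> \<in> auto G"
  shows "index_perm \<sigma> permutes {..<n}"
proof (rule bij_imp_permutes)
  have "bij_betw (inv_into {..<n} g \<circ> (\<sigma> \<circ> g)) {..<n} {..<n}"
    using bij_betw_inv_into[OF enum] auto_bij_nonone[OF \<sigma>] enum by (blast intro: bij_betw_trans)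
  then show "bij_betw (index_perm \<sigma>) {..<n} {..<n}"
    by (rule bij_betw_cong[THEN iffD1, rotated]) (simp add: index_perm_def)
qed (simp add: index_perm_def)

text \<open>This gives multiplicativity for the product of \<open>AutoGroup\<close>, which is
  \<open>compose\<close> on the carrier.\<close>

lemma index_perm_compose:
  assumes \<sigma>: "\<sigma> \<in> auto G" and \<tau>: "\<tau> \<in> auto G"
  shows "index_perm (compose (carrier G) \<sigma> \<tau>) = index_perm \<sigma> \<circ> index_perm \<tau>"
proof
  fix i
  show "index_perm (compose (carrier G) \<sigma> \<tau>) i = (index_perm \<sigma> \<circ> index_perm \<tau>) i"
  proof (cases "i < n")
    case True
    have lt: "index_perm \<tau> i < n" "index_perm \<sigma> (index_perm \<tau> i) < n"
      using True permutes_in_image[OF index_perm_permutes[OF \<tau>]]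
        permutes_in_image[OF index_perm_permutes[OF \<sigma>]] by auto
    have "compose (carrier G) \<sigma> \<tau> (g i) = g (index_perm \<sigma> (index_perm \<tau> i))"
      using True lt enum_closed by (simp add: compose_eq enum_index_perm \<sigma> \<tau>)
    then have "index_perm (compose (carrier G) \<sigma> \<tau>) i = index_perm \<sigma> (index_perm \<tau> i)"
      using True lt(2) by (intro index_perm_eqI)
    then show ?thesis by simp
  qed (simp add: index_perm_def)
qed

text \<open>An automorphism fixes \<open>\<one>\<close>, is determined on the other elements by the
  indices of its values, and is extensional off the carrier.\<close>

lemma index_perm_inj:
  assumes \<sigma>: "\<sigma> \<in> auto G" and \<tau>: "\<tau> \<in> auto G"
    and eq: "\<And>i. i < n \<Longrightarrow> index_perm \<sigma> i = index_perm \<tau> i"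
  shows "\<sigma> = \<tau>"
proof (rule extensionalityI)
  show "\<sigma> \<in> extensional (carrier G)" "\<tau> \<in> extensional (carrier G)"
    using \<sigma> \<tau> by (auto simp: auto_def Bij_def)
  fix a assume "a \<in> carrier G"
  then show "\<sigma> a = \<tau> a"
  proof (cases rule: carrier_cases)
    case 1
    have "\<sigma> \<one> = \<one>" "\<tau> \<one> = \<one>"
      using \<sigma> \<tau> by (auto simp: auto_def intro: hom_one[OF _ is_group is_group])
    with 1 show ?thesis by simp
  next
    case (2 i)
    then show ?thesis using enum_index_perm[OF \<sigma>, of i] enum_index_perm[OF \<tau>, of i] eq[of i] by simp
  qed
qed

section \<open>Lattice symmetries correspond to automorphisms\<close>

text \<open>Permuting the coefficients applies \<open>\<sigma>\<close> to the combination; since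
  \<open>\<sigma>\<close> is injective and fixes \<open>\<one>\<close>, relations and non-relations
  are both preserved.\<close>

lemma index_perm_preserves_lattice:
  assumes \<sigma>: "\<sigma> \<in> auto G"
  shows "permute_vec (index_perm \<sigma>) ` group_lattice G n g = group_lattice G n g"
proof -
  define p where "p = index_perm \<sigma>"
  have p: "p permutes {..<n}" unfolding p_def by (rule index_perm_permutes[OF \<sigma>])
  have hom: "\<sigma> \<in> hom G G" and inj: "inj_on \<sigma> (carrier G)"
    using \<sigma> by (auto simp: auto_def Bij_def bij_betw_def)
  have iff: "embed n (perm_mat n p *\<^sub>v x) \<in> group_lattice G n g \<longleftrightarrow> embed n x \<in> group_lattice G n g"
    if x: "x \<in> carrier_vec n" for x
  proof -
    have Px: "perm_mat n p *\<^sub>v x \<in> carrier_vec n"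
      using x by (rule mult_mat_vec_carrier[OF perm_mat_carrier])
    have "int_comb n g (perm_mat n p *\<^sub>v x) = int_comb n (g \<circ> p) x"
      by (rule int_comb_perm_mat[OF enum_Pi p x])
    also have "\<dots> = int_comb n (\<sigma> \<circ> g) x"
      unfolding int_comb_def using hom enum_Pi
      by (intro finprod_cong') (auto simp: p_def enum_index_perm[OF \<sigma>] hom_def Pi_def)
    also have "\<dots> = \<sigma> (int_comb n g x)" by (rule int_comb_hom[OF hom enum_Pi, symmetric])
    finally have "int_comb n g (perm_mat n p *\<^sub>v x) = \<sigma> (int_comb n g x)" .
    moreover have "\<sigma> (int_comb n g x) = \<one> \<longleftrightarrow> int_comb n g x = \<one>"
      using inj_onD[OF inj, of "int_comb n g x" \<one>] int_comb_closed[OF enum_Pi] hom_one[OF hom] is_group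
      by auto
    ultimately show ?thesis using x Px by (simp add: embed_in_group_lattice_iff)
  qed
  show ?thesis unfolding p_def[symmetric]
  proof (intro equalityI subsetI)
    fix v assume "v \<in> permute_vec p ` group_lattice G n g"
    then obtain x where x: "x \<in> carrier_vec n" "embed n x \<in> group_lattice G n g"
      and v: "v = permute_vec p (embed n x)"
      by (auto simp: group_lattice_def)
    then show "v \<in> group_lattice G n g" using iff by (simp add: embed_perm_mat[OF p, symmetric])
  next
    fix v assume v_in: "v \<in> group_lattice G n g"
    then obtain x where x: "x \<in> carrier_vec n" and v: "v = embed n x"
      by (auto simp: group_lattice_def)
    \<comment> \<open>The preimage of \<open>x\<close> under the permutation matrix; the equivalence
      \<open>iff\<close>, applied to it, puts it in the lattice.\<close>
    define y where "y = perm_mat n (Hilbert_Choice.inv p) *\<^sub>v x"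
    have y: "y \<in> carrier_vec n"
      unfolding y_def using x by (rule mult_mat_vec_carrier[OF perm_mat_carrier])
    have "perm_mat n p *\<^sub>v y = (perm_mat n p * perm_mat n (Hilbert_Choice.inv p)) *\<^sub>v x"
      unfolding y_def by (rule assoc_mult_mat_vec[OF perm_mat_carrier perm_mat_carrier x, symmetric])
    then have Py: "perm_mat n p *\<^sub>v y = x"
      using x by (simp add: perm_mat_mult[OF permutes_inv[OF p]] permutes_inv_o[OF p] perm_mat_id)
    have "embed n y \<in> group_lattice G n g" using iff[OF y] v_in by (simp add: Py v)
    moreover have "v = permute_vec p (embed n y)"
      by (simp add: embed_perm_mat[OF p y, symmetric] Py v)
    ultimately show "v \<in> permute_vec p ` group_lattice G n g" by blast
  qed
qed

text \<open>Relations with at most three terms already determine all products of nonidentity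
  elements, so a permutation preserving them induces a homomorphism.\<close>

lemma index_perm_surj:
  assumes p: "p permutes {..<n}"
    and lat: "permute_vec p ` group_lattice G n g = group_lattice G n g"
  obtains \<sigma> where "\<sigma> \<in> auto G" "index_perm \<sigma> = p"
proof -
  have gp: "g \<circ> p \<in> {..<n} \<rightarrow> carrier G"
    using enum_Pi permutes_in_image[OF p] by auto
  have p_less: "p i < n" if "i < n" for i using permutes_in_image[OF p, of i] that by simp
  \<comment> \<open>Invariance of the lattice carries each relation among the \<open>g i\<close> to
    the same relation among the \<open>g (p i)\<close>.\<close>
  have rel: "int_comb n (g \<circ> p) x = \<one>" if x: "x \<in> carrier_vec n" and "int_comb n g x = \<one>" for x
  proof -
    have "embed n x \<in> group_lattice G n g" using that by (simp add: embed_in_group_lattice_iff)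
    then have "embed n (perm_mat n p *\<^sub>v x) \<in> group_lattice G n g"
      using lat x by (auto simp: embed_perm_mat[OF p])
    then have "int_comb n g (perm_mat n p *\<^sub>v x) = \<one>"
      using x by (subst (asm) embed_in_group_lattice_iff)
        (auto intro: mult_mat_vec_carrier[OF perm_mat_carrier])
    then show ?thesis by (simp add: int_comb_perm_mat[OF enum_Pi p x])
  qed
  \<comment> \<open>The relation used is the sum of two unit vectors; for \<open>i = j\<close> it is
    twice one unit vector.\<close>
  have rel2: "g (p i) \<otimes> g (p j) = \<one>" if ij: "i < n" "j < n" and "g i \<otimes> g j = \<one>" for i j
    using rel[of "unit_vec n i + unit_vec n j"] that enum_closed p_less
    by (simp add: int_comb_add int_comb_unit_vec enum_Pi gp)
  have rel3: "g (p i) \<otimes> g (p j) = g (p k)"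
    if ijk: "i < n" "j < n" "k < n" and "g i \<otimes> g j = g k" for i j k
  proof -
    \<comment> \<open>Stated for arbitrary \<open>h\<close>, to be evaluated at both
      \<open>g\<close> and \<open>g \<circ> p\<close>.\<close>
    have comb: "int_comb n h ((unit_vec n i + unit_vec n j) + (-1) \<cdot>\<^sub>v unit_vec n k)
        = h i \<otimes> h j \<otimes> inv (h k)" if h: "h \<in> {..<n} \<rightarrow> carrier G" for h
      using h ijk by (subst int_comb_add)
        (auto simp: int_comb_add int_comb_unit_vec int_comb_smult_unit_vec int_pow_neg Pi_def)
    have "g i \<otimes> g j \<otimes> inv (g k) = \<one>" using that enum_closed by simp
    then have "g (p i) \<otimes> g (p j) \<otimes> inv (g (p k)) = \<one>"
      using rel[of "(unit_vec n i + unit_vec n j) + (-1) \<cdot>\<^sub>v unit_vec n k"]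
      unfolding comb[OF enum_Pi] comb[OF gp] by simp
    then show ?thesis using ijk enum_closed p_less by (simp add: inv_solve_right')
  qed
  \<comment> \<open>The only candidate: it fixes \<open>\<one>\<close> and sends \<open>g i\<close>
    to \<open>g (p i)\<close>, restricted to the carrier as membership in \<open>auto G\<close>
    requires.\<close>
  define \<sigma> where "\<sigma> = (\<lambda>a\<in>carrier G. if a = \<one> then \<one> else g (p (inv_into {..<n} g a)))"
  have \<sigma>_one: "\<sigma> \<one> = \<one>" by (simp add: \<sigma>_def)
  have \<sigma>_enum: "\<sigma> (g i) = g (p i)" if "i < n" for i
    using that enum_closed enum_not_one bij_betw_imp_inj_on[OF enum]
    by (simp add: \<sigma>_def inv_into_f_f)
  have closed: "\<sigma> a \<in> carrier G" if "a \<in> carrier G" for a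
    using that by (cases rule: carrier_cases) (auto simp: \<sigma>_one \<sigma>_enum enum_closed p_less)
  \<comment> \<open>With both factors different from \<open>\<one>\<close>, \<open>rel2\<close>
    covers a product equal to \<open>\<one>\<close> and \<open>rel3\<close> a product that is some
    \<open>g k\<close>.\<close>
  have mult: "\<sigma> (a \<otimes> b) = \<sigma> a \<otimes> \<sigma> b" if a: "a \<in> carrier G" and b: "b \<in> carrier G" for a b
    using a
  proof (cases rule: carrier_cases)
    case 1
    then show ?thesis using b closed by (simp add: \<sigma>_one)
  next
    case i: (2 i)
    show ?thesis using b
    proof (cases rule: carrier_cases)
      case 1
      then show ?thesis using a closed by (simp add: \<sigma>_one)
    next
      case j: (2 j)
      have "a \<otimes> b \<in> carrier G" using a b by simp
      then show ?thesis
      proof (cases rule: carrier_cases)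
        case 1
        then show ?thesis using rel2 i j by (simp add: \<sigma>_one \<sigma>_enum)
      next
        case (2 k)
        then show ?thesis using rel3 i j by (simp add: \<sigma>_enum)
      qed
    qed
  qed
  have "inj_on \<sigma> (carrier G)"
  proof (rule inj_onI)
    fix a b assume a: "a \<in> carrier G" and b: "b \<in> carrier G" and eq: "\<sigma> a = \<sigma> b"
    have g_inj: "i = j" if "i < n" "j < n" "g i = g j" for i j
      using that inj_onD[OF bij_betw_imp_inj_on[OF enum]] by simp
    have gp_not_one: "g (p i) \<noteq> \<one>" if "i < n" for i
      using enum_not_one[OF p_less[OF that]] .
    show "a = b" using a
    proof (cases rule: carrier_cases)
      case 1
      show ?thesis using b
      proof (cases rule: carrier_cases)
        case (2 j)
        then have "g (p j) = \<one>" using eq 1 by (simp add: \<sigma>_one \<sigma>_enum)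
        then show ?thesis using gp_not_one 2 by blast
      qed (use 1 in simp)
    next
      case i: (2 i)
      show ?thesis using b
      proof (cases rule: carrier_cases)
        case 1
        then have "g (p i) = \<one>" using eq i by (simp add: \<sigma>_one \<sigma>_enum)
        then show ?thesis using gp_not_one i by blast
      next
        case j: (2 j)
        have "g (p i) = g (p j)" using eq i j by (simp add: \<sigma>_enum)
        then have "p i = p j" by (rule g_inj[OF p_less[OF i(1)] p_less[OF j(1)]])
        then have "i = j" by (rule injD[OF permutes_inj[OF p]])
        then show ?thesis using i j by simp
      qed
    qed
  qed
  moreover have "\<sigma> ` carrier G = carrier G"
  proof (intro equalityI subsetI)
    fix b assume b: "b \<in> carrier G"
    then show "b \<in> \<sigma> ` carrier G"
    proof (cases rule: carrier_cases)
      case 1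
      then show ?thesis using \<sigma>_one by (metis imageI one_closed)
    next
      case (2 i)
      then have "Hilbert_Choice.inv p i < n" using permutes_in_image[OF permutes_inv[OF p], of i] by simp
      \<comment> \<open>The preimage of \<open>g i\<close> is found by pulling its index back along
        \<open>p\<close>.\<close>
      then have "\<sigma> (g (Hilbert_Choice.inv p i)) = b" "g (Hilbert_Choice.inv p i) \<in> carrier G"
        by (simp_all add: \<sigma>_enum permutes_inverses[OF p] 2 enum_closed)
      then show ?thesis by blast
    qed
  qed (use closed in auto)
  ultimately have "\<sigma> \<in> auto G"
    using closed mult by (auto simp: auto_def hom_def Bij_def bij_betw_def) (simp add: \<sigma>_def)
  moreover have "index_perm \<sigma> = p"
  proof
    fix i
    show "index_perm \<sigma> i = p i"
      using permutes_not_in[OF p, of i] p_less[of i] \<sigma>_enum[of i] index_perm_eqI[of i "p i" \<sigma>]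
      by (cases "i < n") (auto simp: index_perm_def)
  qed
  ultimately show ?thesis by (rule that)
qed

section \<open>The group isomorphism\<close>

lemma perm_mat_index_perm_iso:
  "(\<lambda>\<sigma>. perm_mat n (index_perm \<sigma>)) \<in> iso (AutoGroup G)
     (GL_int n \<lparr>carrier := lattice_aut_mat n (group_lattice G n g) \<inter> perm_mats n\<rparr>)"
proof -
  let ?L = "group_lattice G n g"
  let ?f = "\<lambda>\<sigma>. perm_mat n (index_perm \<sigma>)"
  have L: "?L \<subseteq> root_lattice n" by (auto simp: group_lattice_def root_lattice_def)
  \<comment> \<open>The matrix determines the index permutation below \<open>n\<close>, and this
    determines the automorphism.\<close>
  have inj: "inj_on ?f (auto G)"
    using perm_mat_eqD index_perm_permutes by (intro inj_onI index_perm_inj) blast+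
  have im: "?f ` auto G = lattice_aut_mat n ?L \<inter> perm_mats n"
  proof (intro equalityI subsetI)
    fix U assume "U \<in> ?f ` auto G"
    then show "U \<in> lattice_aut_mat n ?L \<inter> perm_mats n"
      using perm_mat_in_lattice_aut_mat_iff[OF index_perm_permutes L] index_perm_preserves_lattice
        index_perm_permutes by (auto simp: perm_mats_def)
  next
    fix U assume U: "U \<in> lattice_aut_mat n ?L \<inter> perm_mats n"
    then obtain p where p: "p permutes {..<n}" and U_eq: "U = perm_mat n p"
      by (auto simp: perm_mats_def)
    then have "permute_vec p ` ?L = ?L"
      using U perm_mat_in_lattice_aut_mat_iff[OF p L] by simp
    then obtain \<sigma> where "\<sigma> \<in> auto G" "index_perm \<sigma> = p" by (rule index_perm_surj[OF p])
    then show "U \<in> ?f ` auto G" using U_eq by blast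
  qed
  have "?f (compose (carrier G) \<sigma> \<tau>) = ?f \<sigma> * ?f \<tau>" if "\<sigma> \<in> auto G" "\<tau> \<in> auto G" for \<sigma> \<tau>
    using that by (simp add: index_perm_compose perm_mat_mult index_perm_permutes)
  moreover have "auto G \<subseteq> Bij (carrier G)" by (auto simp: auto_def)
  ultimately show ?thesis
    using inj im
    by (auto simp: iso_def hom_def bij_betw_def AutoGroup_def BijGroup_def GL_int_def
        units_of_mult ring_mat_simps subset_iff)
qed

end

theorem theorem1p5:
  fixes G :: "('a, 'b) monoid_scheme" and n :: nat and g :: "nat \<Rightarrow> 'a"
  assumes "comm_group G"
    and "finite (carrier G)"
    and "card (carrier G) = n + 1"
    and "bij_betw g {..<n} (carrier G - {\<one>\<^bsub>G\<^esub>})"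
  shows "GL_int n \<lparr>carrier := lattice_aut_mat n (group_lattice G n g) \<inter> perm_mats n\<rparr>
           \<cong> AutoGroup G"
proof -
  interpret enumerated_comm_group G n g
    using assms(1,4) by (simp add: enumerated_comm_group_def enumerated_comm_group_axioms_def)
  have "AutoGroup G \<cong> GL_int n \<lparr>carrier := lattice_aut_mat n (group_lattice G n g) \<inter> perm_mats n\<rparr>"
    using perm_mat_index_perm_iso unfolding is_iso_def by blast
  \<comment> \<open>Symmetry of \<open>\<cong>\<close> asks for a group on the source side; mapping
    out of \<open>AutoGroup G\<close> makes this the standard fact that automorphisms form a
    group.\<close>
  then show ?thesis by (rule group.iso_sym[OF AutoGroup])
qed

end
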